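(* Let $G$ be a connected, claw-free, cubic graph with $G \ne K_4$. Then (a) $Z(G) \le \alpha(G)+1$, and (b) $Z(G) \le \alpha'(G)$.
   Context: All graphs are finite and simple. A graph is cubic if every vertex has degree $3$, and claw-free if it contains no induced subgraph isomorphic to $K_{1,3}$. $\alpha(G)$ is the independence number (maximum size of a set of pairwise nonadjacent vertices) and $\alpha'(G)$ is the matching number (maximum number of pairwise disjoint edges). Zero forcing: given a set $S\subseteq V(G)$ of initially colored vertices (all others uncolored), repeatedly apply the rule: if a colored vertex has exactly one uncolored neighbor, that neighbor becomes colored. $S$ is a zero forcing set if iterating this rule eventually colors all of $V(G)$. $Z(G)$, the zero forcing number, is the minimum cardinality of a zero forcing set of $G$. *)

theory Defs
  imports "Graph_Theory.Graph_Theory"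
begin

text \<open>
  Finite simple graphs are the symmetric loop-free digraphs without parallel arcs of the locale
  \<^locale>\<open>graph\<close>; an undirected edge is a pair of opposite arcs.
\<close>

text \<open>In a symmetric digraph the out-degree of a vertex is its number of neighbors.\<close>

definition cubic :: "('a, 'b) pre_digraph \<Rightarrow> bool" where
  "cubic G \<longleftrightarrow> (\<forall>v \<in> verts G. out_degree G v = 3)"

text \<open>The predicate \<open>K\<^bsub>1,3\<^esub> H\<close> says that \<open>H\<close> is isomorphic to the claw.\<close>

definition claw_free :: "('a, 'b) pre_digraph \<Rightarrow> bool" where
  "claw_free G \<longleftrightarrow> \<not> (\<exists>H. induced_subgraph H G \<and> K\<^bsub>1,3\<^esub> H)"

definition independent_set :: "('a, 'b) pre_digraph \<Rightarrow> 'a set \<Rightarrow> bool" where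
  "independent_set G I \<longleftrightarrow> I \<subseteq> verts G \<and> (\<forall>u \<in> I. \<forall>v \<in> I. u \<noteq> v \<longrightarrow> \<not> u \<rightarrow>\<^bsub>G\<^esub> v)"

definition independence_number :: "('a, 'b) pre_digraph \<Rightarrow> nat" where
  "independence_number G = Max (card ` {I. independent_set G I})"

definition edges :: "('a, 'b) pre_digraph \<Rightarrow> 'a set set" where
  "edges G = {{u, v} | u v. u \<rightarrow>\<^bsub>G\<^esub> v}"

definition matching :: "('a, 'b) pre_digraph \<Rightarrow> 'a set set \<Rightarrow> bool" where
  "matching G M \<longleftrightarrow> M \<subseteq> edges G \<and> pairwise disjnt M"

definition matching_number :: "('a, 'b) pre_digraph \<Rightarrow> nat" where
  "matching_number G = Max (card ` {M. matching G M})"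

text \<open>One application of the rule: the colored set grows from \<open>C\<close> to \<open>C'\<close>.\<close>

definition force_step :: "('a, 'b) pre_digraph \<Rightarrow> 'a set \<Rightarrow> 'a set \<Rightarrow> bool" where
  "force_step G C C' \<longleftrightarrow> (\<exists>u \<in> C. \<exists>v. {w. u \<rightarrow>\<^bsub>G\<^esub> w \<and> w \<notin> C} = {v} \<and> C' = insert v C)"

definition zero_forcing_set :: "('a, 'b) pre_digraph \<Rightarrow> 'a set \<Rightarrow> bool" where
  "zero_forcing_set G S \<longleftrightarrow> S \<subseteq> verts G \<and> (force_step G)\<^sup>*\<^sup>* S (verts G)"

definition zero_forcing_number :: "('a, 'b) pre_digraph \<Rightarrow> nat" where
  "zero_forcing_number G = Min (card ` {S. zero_forcing_set G S})"

text \<open>In a finite graph, these extrema are taken over finite nonempty sets.\<close>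

context graph
begin

lemma finite_independent_sets: "finite {I. independent_set G I}"
  by (rule finite_subset[of _ "Pow (verts G)"]) (auto simp: independent_set_def)

lemma independent_set_empty: "independent_set G {}"
  by (simp add: independent_set_def)

lemma finite_matchings: "finite {M. matching G M}"
proof (rule finite_subset)
  show "{M. matching G M} \<subseteq> Pow (Pow (verts G))"
    by (auto simp: matching_def edges_def arcs_ends_conv)
qed simp

lemma matching_empty: "matching G {}"
  by (simp add: matching_def)

lemma finite_zero_forcing_sets: "finite {S. zero_forcing_set G S}"
  by (rule finite_subset[of _ "Pow (verts G)"]) (auto simp: zero_forcing_set_def)

lemma zero_forcing_set_verts: "zero_forcing_set G (verts G)"
  by (simp add: zero_forcing_set_def)

end

end

theory Submission
  imports Defs
begin

text \<open>
  Every vertex lies in exactly one unit: a diamond (\<open>K\<^sub>4\<close> minus an edge) or a triangle whose three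
  vertices have distinct outer neighbors. Explore the graph unit by unit. A unit entered from the
  explored part is forced completely at the price of one extra colored vertex; it also contributes a
  new independent vertex (the entry vertex of a triangle, a central vertex of a diamond) and a new
  matching edge (two in a diamond). Only the first unit costs three colored vertices.

  If there are only diamonds, the first one contributes both of its tips to the independent set.
  Otherwise some triangle \<open>T\<close> has two outer neighbors in one component of \<open>G - T\<close>: if not, there is
  a bridge, and a smallest union of units with a single leaving edge leads to a contradiction. Explore
  that component first, starting at an outer neighbor \<open>x'\<close> of \<open>T\<close>. Then \<open>T\<close> is forced from two sides
  at no cost and still contributes an independent vertex, and \<open>T\<close> and the unit of \<open>x'\<close> together
  contain a matching of three edges.
\<close>

section \<open>Decomposition into triangles and diamonds\<close>

locale connected_claw_free_cubic = graph G for G :: "('a, 'b) pre_digraph" (structure) +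
  assumes conn: "Digraph_Component.connected G"
    and claw: "claw_free G"
    and cub: "cubic G"
    and not_K4: "\<not> K\<^bsub>4\<^esub> G"
begin

section \<open>Neighborhoods in a connected cubic claw-free graph\<close>

definition nbs :: "'a \<Rightarrow> 'a set" where
  "nbs v = {w. v \<rightarrow> w}"

lemma nbs_sym: "w \<in> nbs v \<longleftrightarrow> v \<in> nbs w"
  unfolding nbs_def using graph_symmetric by blast

lemma nbs_irrefl: "v \<notin> nbs v"
  unfolding nbs_def using adj_not_same by blast

lemma nbs_verts: "w \<in> nbs v \<Longrightarrow> v \<in> verts G \<and> w \<in> verts G"
  unfolding nbs_def using adj_in_verts by blast

text \<open>Without parallel arcs, distinct outgoing arcs have distinct heads, so the out-degree
  counts neighbors.\<close>

lemma card_nbs: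
  assumes "v \<in> verts G"
  shows "card (nbs v) = 3"
proof -
  have "nbs v = head G ` out_arcs G v"
    by (auto simp: nbs_def out_arcs_def arcs_ends_conv)
  moreover have "inj_on (head G) (out_arcs G v)"
    by (rule inj_onI) (auto simp: out_arcs_def arc_to_ends_def intro!: no_multi_arcs)
  ultimately show ?thesis
    using cub assms by (simp add: card_image cubic_def out_degree_def)
qed

lemma third_neighbor:
  assumes "x \<in> nbs v" "y \<in> nbs v" "x \<noteq> y"
  obtains z where "nbs v = {x, y, z}" "z \<noteq> x" "z \<noteq> y" "z \<noteq> v"
proof -
  have "card (nbs v) = 3"
    using card_nbs nbs_verts assms by blast
  then obtain p q r where *: "nbs v = {p, q, r}" "p \<noteq> q" "p \<noteq> r" "q \<noteq> r"
    by (auto simp: card_3_iff)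
  then have "\<exists>z. nbs v = {x, y, z} \<and> z \<noteq> x \<and> z \<noteq> y"
    using assms by auto
  then show ?thesis
    using that nbs_irrefl by blast
qed

text \<open>Otherwise \<open>v\<close> with the three neighbors would induce a claw. Most of the
  work is to recognize the induced subdigraph as a complete bipartite \<open>graph\<close>.\<close>

lemma no_independent_triple:
  assumes "a \<in> nbs v" "b \<in> nbs v" "c \<in> nbs v" "a \<noteq> b" "a \<noteq> c" "b \<noteq> c"
  shows "b \<in> nbs a \<or> c \<in> nbs a \<or> c \<in> nbs b"
proof (rule ccontr)
  assume non: "\<not> ?thesis"
  let ?H = "G \<restriction> {v, a, b, c}"
  have sub: "{v, a, b, c} \<subseteq> verts G"
    using assms nbs_verts by blast
  then have ind: "induced_subgraph ?H G"
    by (rule induced_induce)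
  interpret H: wf_digraph ?H
    using ind by (rule wf_digraphI_induced)
  have ends: "arcs_ends ?H = {(x, y). x \<in> {v, a, b, c} \<and> y \<in> {v, a, b, c} \<and> y \<in> nbs x}"
    by (auto simp: nbs_def arcs_ends_conv)
  have ne: "v \<noteq> a" "v \<noteq> b" "v \<noteq> c"
    using assms nbs_irrefl by auto
  \<comment> \<open>Under the assumption \<open>non\<close>, the only edges among the four vertices
    are those at the center \<open>v\<close>.\<close>
  have rel: "y \<in> nbs x \<longleftrightarrow> (x = v) \<noteq> (y = v)" if "x \<in> {v, a, b, c}" "y \<in> {v, a, b, c}" for x y
    using that assms non ne nbs_sym nbs_irrefl by (auto; metis)
  have ends': "arcs_ends ?H = {v} \<times> {a, b, c} \<union> {a, b, c} \<times> {v}"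
    unfolding ends using rel ne by auto
  have "graph ?H"
  proof
    show "finite (verts ?H)" "finite (arcs ?H)" by auto
    show "tail ?H e \<noteq> head ?H e" if "e \<in> arcs ?H" for e
      using that no_loops by auto
    show "e1 = e2" if "e1 \<in> arcs ?H" "e2 \<in> arcs ?H" "arc_to_ends ?H e1 = arc_to_ends ?H e2" for e1 e2
      using that no_multi_arcs by (auto simp: arc_to_ends_def)
    show "symmetric ?H"
      unfolding symmetric_def ends' by (auto intro: symI)
  qed
  moreover have "card {a, b, c} = 3"
    using assms by simp
  moreover have "verts ?H = {v} \<union> {a, b, c}" "{v} \<inter> {a, b, c} = {}" "card {v} = 1"
    using ne by auto
  ultimately have "K\<^bsub>1,3\<^esub> ?H"
    unfolding complete_bipartite_digraph_def using ends' by blast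
  then show False
    using claw ind unfolding claw_free_def by blast
qed

text \<open>A path from a vertex of \<open>X\<close> to one outside, which exists by connectivity,
  must cross the boundary of \<open>X\<close>.\<close>

lemma leaving_edge:
  assumes "X \<subseteq> verts G" "X \<noteq> {}" "X \<noteq> verts G"
  obtains u v where "u \<in> X" "v \<notin> X" "v \<in> nbs u"
proof -
  obtain x y where xy: "x \<in> X" "y \<in> verts G" "y \<notin> X"
    using assms by blast
  have "strongly_connected G"
    using conn by (rule symmetric_connected_imp_strongly_connected[OF sym_arcs])
  then have "x \<rightarrow>\<^sup>* y"
    using xy assms unfolding strongly_connected_def by blast
  then have "x \<in> X \<longrightarrow> y \<notin> X \<longrightarrow> (\<exists>u v. u \<in> X \<and> v \<notin> X \<and> v \<in> nbs u)"
    by (induction rule: reachable_induct) (auto simp: nbs_def)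
  then show ?thesis
    using xy that by blast
qed

lemma no_four_clique:
  assumes "nbs b = {a, c, e}" "nbs c = {a, b, e}" "distinct [a, b, c, e]"
  shows "e \<notin> nbs a"
proof
  assume e: "e \<in> nbs a"
  have *: "b \<in> nbs a" "c \<in> nbs a" "b \<in> nbs e" "c \<in> nbs e" "a \<in> nbs e"
    using assms e nbs_sym by auto
  have na: "nbs a = {b, c, e}"
  proof -
    obtain z where "nbs a = {b, c, z}"
      using third_neighbor[OF *(1,2)] assms(3) by auto
    then show ?thesis
      using e assms(3) by auto
  qed
  have nn: "nbs e = {a, b, c}"
  proof -
    obtain z where "nbs e = {b, c, z}"
      using third_neighbor[OF *(3,4)] assms(3) by auto
    then show ?thesis
      using *(5) assms(3) by auto
  qed
  have V: "verts G = {a, b, c, e}"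
  proof (rule ccontr)
    assume "verts G \<noteq> {a, b, c, e}"
    moreover have "{a, b, c, e} \<subseteq> verts G"
      using * nbs_verts by blast
    ultimately obtain u v where "u \<in> {a, b, c, e}" "v \<notin> {a, b, c, e}" "v \<in> nbs u"
      using leaving_edge[of "{a, b, c, e}"] by blast
    then show False
      by (elim insertE emptyE) (simp_all add: na nn assms(1,2))
  qed
  have "arcs_ends G = {(u, v). v \<in> nbs u}"
    by (auto simp: nbs_def)
  also have "\<dots> = {(u, v). (u, v) \<in> verts G \<times> verts G \<and> u \<noteq> v}"
  proof -
    have "v \<in> nbs u" if "u \<in> verts G" "v \<in> verts G" "u \<noteq> v" for u v
      using that unfolding V by (elim insertE emptyE) (simp_all add: na nn assms(1,2))
    then show ?thesis
      using nbs_verts nbs_irrefl by blast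
  qed
  finally have "K\<^bsub>4\<^esub> G"
    unfolding complete_digraph_def
  proof (intro conjI graph_axioms)
    show "card (verts G) = 4" using V assms(3) by simp
  qed
  then show False
    using not_K4 by blast
qed

text \<open>The primed vertices are the neighbors outside the unit; \<open>a\<close> and \<open>e\<close> are the tips of a diamond.\<close>

definition triangle_unit :: "'a \<Rightarrow> 'a \<Rightarrow> 'a \<Rightarrow> 'a \<Rightarrow> 'a \<Rightarrow> 'a \<Rightarrow> bool" where
  "triangle_unit x y z x' y' z' \<longleftrightarrow> distinct [x, y, z, x', y', z'] \<and>
     nbs x = {y, z, x'} \<and> nbs y = {x, z, y'} \<and> nbs z = {x, y, z'}"

definition diamond_unit :: "'a \<Rightarrow> 'a \<Rightarrow> 'a \<Rightarrow> 'a \<Rightarrow> 'a \<Rightarrow> 'a \<Rightarrow> bool" where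
  "diamond_unit a b c e a' e' \<longleftrightarrow> distinct [a, b, c, e] \<and> a' \<notin> {a, b, c, e} \<and> e' \<notin> {a, b, c, e} \<and>
     nbs a = {b, c, a'} \<and> nbs b = {a, c, e} \<and> nbs c = {a, b, e} \<and> nbs e = {b, c, e'}"

definition units :: "'a set set" where
  "units = {{x, y, z} | x y z. \<exists>x' y' z'. triangle_unit x y z x' y' z'} \<union>
     {{a, b, c, e} | a b c e. \<exists>a' e'. diamond_unit a b c e a' e'}"

section \<open>Labelled units, their symmetries, and the partition into units\<close>

lemma triangle_unitD:
  assumes "triangle_unit x y z x' y' z'"
  shows "nbs x = {y, z, x'}" "nbs y = {x, z, y'}" "nbs z = {x, y, z'}"
    "distinct [x, y, z, x', y', z']"
  using assms unfolding triangle_unit_def by simp_all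

lemma diamond_unitD:
  assumes "diamond_unit a b c e a' e'"
  shows "nbs a = {b, c, a'}" "nbs b = {a, c, e}" "nbs c = {a, b, e}" "nbs e = {b, c, e'}"
    "distinct [a, b, c, e]" "a' \<notin> {a, b, c, e}" "e' \<notin> {a, b, c, e}"
  using assms unfolding diamond_unit_def by simp_all

lemma triangle_in_units: "triangle_unit x y z x' y' z' \<Longrightarrow> {x, y, z} \<in> units"
  unfolding units_def by (intro UnI1 CollectI exI conjI) (rule refl)

lemma diamond_in_units: "diamond_unit a b c e a' e' \<Longrightarrow> {a, b, c, e} \<in> units"
  unfolding units_def by (intro UnI2 CollectI exI conjI) (rule refl)

lemma triangle_unit_perm:
  assumes "triangle_unit x y z x' y' z'"
  shows "triangle_unit y x z y' x' z'" "triangle_unit y z x y' z' x'" "triangle_unit z x y z' x' y'"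
    "triangle_unit x z y x' z' y'"
proof -
  note d = triangle_unitD[OF assms]
  show "triangle_unit y x z y' x' z'" "triangle_unit y z x y' z' x'" "triangle_unit z x y z' x' y'"
    "triangle_unit x z y x' z' y'"
    unfolding triangle_unit_def d(1-3) using d(4) by auto
qed

lemma diamond_unit_perm:
  assumes "diamond_unit a b c e a' e'"
  shows "diamond_unit e b c a e' a'" "diamond_unit a c b e a' e'"
proof -
  note d = diamond_unitD[OF assms]
  show "diamond_unit e b c a e' a'" "diamond_unit a c b e a' e'"
    unfolding diamond_unit_def d(1-4) using d(5-7) by auto
qed

text \<open>The tips \<open>a\<close> and \<open>e\<close> are nonadjacent by
  \<open>no_four_clique\<close>, so their third neighbors lie outside the four vertices.\<close>

lemma diamond_unitI:
  assumes "nbs b = {a, c, e}" "nbs c = {a, b, e}" "distinct [a, b, c, e]"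
  shows "\<exists>a' e'. diamond_unit a b c e a' e'"
proof -
  have no: "e \<notin> nbs a" "a \<notin> nbs e"
    using no_four_clique[OF assms] nbs_sym by auto
  have *: "b \<in> nbs a" "c \<in> nbs a" "b \<in> nbs e" "c \<in> nbs e" "b \<noteq> c"
    using assms nbs_sym by auto
  obtain a' where a': "nbs a = {b, c, a'}" "a' \<noteq> b" "a' \<noteq> c" "a' \<noteq> a"
    by (rule third_neighbor[OF *(1,2,5)])
  obtain e' where e': "nbs e = {b, c, e'}" "e' \<noteq> b" "e' \<noteq> c" "e' \<noteq> e"
    by (rule third_neighbor[OF *(3,4,5)])
  have "diamond_unit a b c e a' e'"
    unfolding diamond_unit_def using assms a' e' no by auto
  then show ?thesis by blast
qed

text \<open>Two of the neighbors of \<open>v\<close> are adjacent, so \<open>v\<close> lies in a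
  triangle \<open>v p q\<close>; let \<open>r\<close>, \<open>p'\<close>, \<open>q'\<close> be the
  third neighbors of its vertices. If these are distinct, the triangle is a unit. If two of them
  coincide, the corresponding two triangle vertices are the centers of a diamond.\<close>

lemma unit_exists:
  assumes "v \<in> verts G"
  obtains U where "U \<in> units" "v \<in> U"
proof -
  obtain p q r where v: "nbs v = {p, q, r}" "p \<noteq> q" "p \<noteq> r" "q \<noteq> r" "q \<in> nbs p"
  proof -
    have "card (nbs v) = 3"
      using card_nbs assms by blast
    then obtain p q r where *: "nbs v = {p, q, r}" "p \<noteq> q" "p \<noteq> r" "q \<noteq> r"
      by (auto simp: card_3_iff)
    then have "q \<in> nbs p \<or> r \<in> nbs p \<or> r \<in> nbs q"
      using no_independent_triple[of p v q r] by auto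
    then show ?thesis
      using that[of p q r] that[of p r q] that[of q r p] * by blast
  qed
  have ne: "v \<noteq> p" "v \<noteq> q" "v \<noteq> r"
    using v(1) nbs_irrefl by auto
  have *: "v \<in> nbs p" "v \<in> nbs q" "p \<in> nbs q"
    using v nbs_sym by auto
  obtain p' where p': "nbs p = {v, q, p'}" "p' \<noteq> v" "p' \<noteq> q" "p' \<noteq> p"
    using third_neighbor[OF *(1) v(5)] ne by blast
  obtain q' where q': "nbs q = {v, p, q'}" "q' \<noteq> v" "q' \<noteq> p" "q' \<noteq> q"
    using third_neighbor[OF *(2,3)] ne by blast
  have "\<exists>U\<in>units. v \<in> U"
  proof (cases "p' = r \<or> q' = r \<or> p' = q'")
    case True
    then consider "p' = r" | "q' = r" | "p' = q'" by blast
    then have "(\<exists>a' e'. diamond_unit q v p r a' e') \<or> (\<exists>a' e'. diamond_unit p v q r a' e') \<or>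
      (\<exists>a' e'. diamond_unit v p q p' a' e')"
    proof cases
      case 1
      have "nbs v = {q, p, r}" "nbs p = {q, v, r}" using v p' 1 by auto
      then show ?thesis using diamond_unitI[of v q p r] v ne by simp
    next
      case 2
      have "nbs v = {p, q, r}" "nbs q = {p, v, r}" using v q' 2 by auto
      then show ?thesis using diamond_unitI[of v p q r] v ne by simp
    next
      case 3
      have "nbs p = {v, q, p'}" "nbs q = {v, p, p'}" using p' q' 3 by auto
      then show ?thesis using diamond_unitI[of p v q p'] p' q' v ne by simp
    qed
    \<comment> \<open>Up to renaming, \<open>v\<close> is either a center or a tip of the diamond
      found.\<close>
    then obtain a c e a' e' where "diamond_unit a v c e a' e' \<or> diamond_unit v a c e a' e'"
      using diamond_unit_perm(2) by blast
    then have "{a, v, c, e} \<in> units \<or> {v, a, c, e} \<in> units"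
      using diamond_in_units by blast
    moreover have "v \<in> {a, v, c, e}" "v \<in> {v, a, c, e}"
      by simp_all
    ultimately show ?thesis
      by metis
  next
    case False
    then have "triangle_unit v p q r p' q'"
      unfolding triangle_unit_def using v(1-4) p' q' ne by (simp add: eq_commute insert_commute)
    then have "{v, p, q} \<in> units"
      by (rule triangle_in_units)
    then show ?thesis
      by (rule bexI[rotated]) simp
  qed
  then show ?thesis
    using that by blast
qed

lemma units_cases:
  assumes "U \<in> units"
  obtains x y z x' y' z' where "U = {x, y, z}" "triangle_unit x y z x' y' z'"
  | a b c e a' e' where "U = {a, b, c, e}" "diamond_unit a b c e a' e'"
proof -
  have "(\<exists>x y z x' y' z'. U = {x, y, z} \<and> triangle_unit x y z x' y' z') \<or>
    (\<exists>a b c e a' e'. U = {a, b, c, e} \<and> diamond_unit a b c e a' e')"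
    using assms unfolding units_def by simp
  then show ?thesis
    by (elim disjE exE conjE) (erule (1) that)+
qed

text \<open>An edge that leaves a unit lies in no triangle. For a triangle unit this is the
  distinctness of the outer neighbors; in a diamond only tips have outer neighbors, and the other
  neighbors of a tip are centers, which have none.\<close>

lemma triangle_in_unit:
  assumes "U \<in> units" "v \<in> U" "p \<in> nbs v" "q \<in> nbs v" "q \<in> nbs p"
  shows "p \<in> U"
proof (rule ccontr)
  assume p: "p \<notin> U"
  have pq: "q \<noteq> p" "p \<in> nbs q"
    using assms nbs_irrefl nbs_sym by auto
  show False
    using assms(1)
  proof (cases rule: units_cases)
    case (1 x y z x' y' z')
    note d = triangle_unitD[OF 1(2)]
    have "v = x \<and> p = x' \<or> v = y \<and> p = y' \<or> v = z \<and> p = z'"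
      using p assms(2,3) unfolding 1(1) by (elim insertE emptyE) (simp_all add: d)
    then have "q \<in> U - {v}"
      using assms(4) pq(1) d(4) unfolding 1(1) by (elim disjE conjE) (simp_all add: d(1-3), blast+)
    moreover have "x' \<notin> nbs y" "x' \<notin> nbs z" "y' \<notin> nbs x" "y' \<notin> nbs z" "z' \<notin> nbs x" "z' \<notin> nbs y"
      using d(4) by (auto simp: d(1-3))
    ultimately have "p \<notin> nbs q"
      using \<open>v = x \<and> _ \<or> _\<close> unfolding 1(1) by (elim disjE conjE insertE DiffE emptyE) simp_all
    then show False
      using pq(2) by blast
  next
    case (2 a b c e a' e')
    note d = diamond_unitD[OF 2(2)]
    have "v = a \<and> p = a' \<or> v = e \<and> p = e'"
      using p assms(2,3) unfolding 2(1) by (elim insertE emptyE) (simp_all add: d)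
    then have "q \<in> {b, c}"
      using assms(4) pq(1) by (elim disjE conjE) (simp_all add: d)
    then have "p \<in> U"
      using pq(2) unfolding 2(1) by (elim insertE emptyE) (simp_all add: d, blast+)
    then show False
      using p by blast
  qed
qed

text \<open>\<open>U'\<close> is made of one triangle or of two triangles sharing an edge, so
  \<open>triangle_in_unit\<close> carries membership in \<open>U\<close> from \<open>v\<close> to
  all of \<open>U'\<close>.\<close>

lemma unit_subset:
  assumes "U \<in> units" "U' \<in> units" "v \<in> U" "v \<in> U'"
  shows "U' \<subseteq> U"
proof -
  note tri = triangle_in_unit[OF assms(1)]
  show ?thesis
    using assms(2)
  proof (cases rule: units_cases)
    case (1 x y z x' y' z')
    note nb = triangle_unitD[OF 1(2)]
    have "y \<in> U" if "x \<in> U" by (rule tri[OF that, of y z]) (simp_all add: nb)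
    moreover have "x \<in> U" if "y \<in> U" by (rule tri[OF that, of x z]) (simp_all add: nb)
    moreover have "z \<in> U" if "y \<in> U" by (rule tri[OF that, of z x]) (simp_all add: nb)
    moreover have "y \<in> U" if "z \<in> U" by (rule tri[OF that, of y x]) (simp_all add: nb)
    ultimately show ?thesis
      using assms(3,4) unfolding 1(1) by blast
  next
    case (2 a b c e a' e')
    note nb = diamond_unitD[OF 2(2)]
    have "b \<in> U" if "a \<in> U" by (rule tri[OF that, of b c]) (simp_all add: nb)
    moreover have "b \<in> U" if "c \<in> U" by (rule tri[OF that, of b a]) (simp_all add: nb)
    moreover have "b \<in> U" if "e \<in> U" by (rule tri[OF that, of b c]) (simp_all add: nb)
    moreover have "a \<in> U" if "b \<in> U" by (rule tri[OF that, of a c]) (simp_all add: nb)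
    moreover have "c \<in> U" if "b \<in> U" by (rule tri[OF that, of c a]) (simp_all add: nb)
    moreover have "e \<in> U" if "b \<in> U" by (rule tri[OF that, of e c]) (simp_all add: nb)
    ultimately show ?thesis
      using assms(3,4) unfolding 2(1) by blast
  qed
qed

lemma unit_unique:
  assumes "U \<in> units" "U' \<in> units" "v \<in> U" "v \<in> U'"
  shows "U' = U"
  using unit_subset assms by (metis subset_antisym)

text \<open>By symmetry the unit can be labelled so that the entry vertex \<open>w\<close> comes
  first; in a diamond it must be a tip. Later case distinctions on units use this form.\<close>

lemma unit_entry:
  assumes "U \<in> units" "w \<in> U" "v \<in> nbs w" "v \<notin> U"
  shows "(\<exists>y z y' z'. U = {w, y, z} \<and> triangle_unit w y z v y' z') \<or>
    (\<exists>b c e e'. U = {w, b, c, e} \<and> diamond_unit w b c e v e')"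
  using assms(1)
proof (cases rule: units_cases)
  case (1 x y z x' y' z')
  note d = triangle_unitD[OF 1(2)] and p = triangle_unit_perm[OF 1(2)]
  have "w = x \<and> v = x' \<or> w = y \<and> v = y' \<or> w = z \<and> v = z'"
    using assms(2-4) unfolding 1(1) by (elim insertE emptyE) (simp_all add: d)
  moreover have "U = {y, x, z}" "U = {z, x, y}"
    using 1(1) by auto
  ultimately show ?thesis
    using 1 p by metis
next
  case (2 a b c e a' e')
  note d = diamond_unitD[OF 2(2)] and p = diamond_unit_perm[OF 2(2)]
  have "w = a \<and> v = a' \<or> w = e \<and> v = e'"
    using assms(2-4) unfolding 2(1) by (elim insertE emptyE) (simp_all add: d)
  moreover have "U = {e, b, c, a}"
    using 2(1) by auto
  ultimately show ?thesis
    using 2 p by metis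
qed

section \<open>Forcing and reachability\<close>

text \<open>The closure under the forcing rule, without reference to the order of the steps; this
  makes it monotone in \<open>S\<close>.\<close>

inductive_set forced :: "'a set \<Rightarrow> 'a set" for S where
  base: "v \<in> S \<Longrightarrow> v \<in> forced S"
| step: "u \<in> forced S \<Longrightarrow> v \<in> nbs u \<Longrightarrow> (\<And>w. w \<in> nbs u \<Longrightarrow> w \<noteq> v \<Longrightarrow> w \<in> forced S) \<Longrightarrow> v \<in> forced S"

lemma forced_mono:
  assumes "S \<subseteq> S'"
  shows "forced S \<subseteq> forced S'"
proof
  fix v assume "v \<in> forced S"
  then show "v \<in> forced S'"
    by induction (use assms in \<open>auto intro: forced.intros\<close>)
qed

text \<open>Take a maximal set \<open>C\<close> obtained by force steps. If a vertex of
  \<open>forced S\<close> were missing, induction over its derivation would give a step that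
  enlarges \<open>C\<close>.\<close>

lemma zero_forcing_setI:
  assumes "S \<subseteq> verts G" "verts G \<subseteq> forced S"
  shows "zero_forcing_set G S"
proof -
  define A where "A = {C. (force_step G)\<^sup>*\<^sup>* S C \<and> S \<subseteq> C \<and> C \<subseteq> verts G}"
  have "finite A"
    unfolding A_def by (rule finite_subset[of _ "Pow (verts G)"]) auto
  moreover have "S \<in> A"
    unfolding A_def using assms by auto
  ultimately have "\<exists>C\<in>A. S \<subseteq> C \<and> (\<forall>D\<in>A. C \<subseteq> D \<longrightarrow> C = D)"
    by (rule finite_has_maximal2)
  then obtain C where "C \<in> A" and max: "\<And>D. D \<in> A \<Longrightarrow> C \<subseteq> D \<Longrightarrow> C = D"
    by blast
  then have C: "(force_step G)\<^sup>*\<^sup>* S C" "S \<subseteq> C" "C \<subseteq> verts G"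
    unfolding A_def by simp_all
  have "v \<in> C" if "v \<in> forced S" for v
    using that
  proof induction
    case (base v)
    then show ?case
      using C by blast
  next
    case (step u v)
    show ?case
    proof (rule ccontr)
      assume "v \<notin> C"
      then have "{w. u \<rightarrow> w \<and> w \<notin> C} = {v}"
        using step unfolding nbs_def by blast
      then have "force_step G C (insert v C)"
        unfolding force_step_def using step.IH(1) by blast
      then have "(force_step G)\<^sup>*\<^sup>* S (insert v C)"
        using C(1) by (rule rtranclp.rtrancl_into_rtrancl[rotated])
      moreover have "v \<in> verts G"
        using step(2) nbs_verts by blast
      ultimately have "insert v C \<in> A"
        unfolding A_def using C by blast
      then show False
        using max[of "insert v C"] \<open>v \<notin> C\<close> by blast
    qed
  qed
  then have "C = verts G"
    using C assms by blast
  then show ?thesis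
    using C assms unfolding zero_forcing_set_def by simp
qed

section \<open>Unions of units, and components after deleting vertices\<close>

definition saturated :: "'a set \<Rightarrow> bool" where
  "saturated X \<longleftrightarrow> (\<forall>U\<in>units. U \<subseteq> X \<or> U \<inter> X = {})"

lemma saturated_unit: "U \<in> units \<Longrightarrow> saturated U"
  unfolding saturated_def using unit_unique by blast

lemma saturated_empty: "saturated {}"
  unfolding saturated_def by blast

lemma saturated_Un: "saturated X \<Longrightarrow> saturated Y \<Longrightarrow> saturated (X \<union> Y)"
  unfolding saturated_def by blast

lemma saturated_Diff: "saturated X \<Longrightarrow> saturated Y \<Longrightarrow> saturated (X - Y)"
  unfolding saturated_def by blast

text \<open>The vertex set of the component of \<open>p\<close> in \<open>G - B\<close>; it is empty if \<open>p \<in> B\<close>.\<close>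

inductive_set reach :: "'a set \<Rightarrow> 'a \<Rightarrow> 'a set" for B p where
  base: "p \<notin> B \<Longrightarrow> p \<in> reach B p"
| step: "u \<in> reach B p \<Longrightarrow> v \<in> nbs u \<Longrightarrow> v \<notin> B \<Longrightarrow> v \<in> reach B p"

lemma reach_avoids: "v \<in> reach B p \<Longrightarrow> v \<notin> B"
  by (erule reach.cases) simp_all

lemma reach_subset:
  assumes "p \<in> X" "\<And>u v. u \<in> X \<Longrightarrow> u \<notin> B \<Longrightarrow> v \<in> nbs u \<Longrightarrow> v \<in> X \<or> v \<in> B"
  shows "reach B p \<subseteq> X"
proof
  fix v assume "v \<in> reach B p"
  then show "v \<in> X"
    by induction (use assms reach_avoids in blast)+
qed

text \<open>Each unit has a vertex adjacent to all its other vertices (\<open>y\<close> in a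
  triangle, \<open>b\<close> in a diamond), and membership in \<open>C\<close> spreads through
  it.\<close>

lemma unit_connected:
  assumes "U \<in> units" "v \<in> U" "v \<in> C" "\<And>s t. s \<in> C \<Longrightarrow> t \<in> nbs s \<Longrightarrow> t \<in> U \<Longrightarrow> t \<in> C"
  shows "U \<subseteq> C"
  using assms(1)
proof (cases rule: units_cases)
  case (1 x y z x' y' z')
  note d = triangle_unitD[OF 1(2)]
  have "y \<in> C" if "x \<in> C" by (rule assms(4)[OF that]) (simp_all add: d 1(1))
  moreover have "x \<in> C" if "y \<in> C" by (rule assms(4)[OF that]) (simp_all add: d 1(1))
  moreover have "z \<in> C" if "y \<in> C" by (rule assms(4)[OF that]) (simp_all add: d 1(1))
  moreover have "y \<in> C" if "z \<in> C" by (rule assms(4)[OF that]) (simp_all add: d 1(1))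
  ultimately show ?thesis
    using assms(2,3) unfolding 1(1) by blast
next
  case (2 a b c e a' e')
  note d = diamond_unitD[OF 2(2)]
  have "b \<in> C" if "a \<in> C" by (rule assms(4)[OF that]) (simp_all add: d 2(1))
  moreover have "b \<in> C" if "c \<in> C" by (rule assms(4)[OF that]) (simp_all add: d 2(1))
  moreover have "b \<in> C" if "e \<in> C" by (rule assms(4)[OF that]) (simp_all add: d 2(1))
  moreover have "a \<in> C" if "b \<in> C" by (rule assms(4)[OF that]) (simp_all add: d 2(1))
  moreover have "c \<in> C" if "b \<in> C" by (rule assms(4)[OF that]) (simp_all add: d 2(1))
  moreover have "e \<in> C" if "b \<in> C" by (rule assms(4)[OF that]) (simp_all add: d 2(1))
  ultimately show ?thesis
    using assms(2,3) unfolding 2(1) by blast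
qed

text \<open>A unit that meets the component avoids the saturated set \<open>B\<close>, and being
  connected it lies in the component.\<close>

lemma saturated_reach:
  assumes "saturated B"
  shows "saturated (reach B p)"
  unfolding saturated_def
proof (intro ballI)
  fix U assume U: "U \<in> units"
  show "U \<subseteq> reach B p \<or> U \<inter> reach B p = {}"
  proof (cases "U \<inter> reach B p = {}")
    case False
    then obtain v where v: "v \<in> U" "v \<in> reach B p"
      by blast
    then have "U \<inter> B = {}"
      using assms U reach_avoids unfolding saturated_def by blast
    then have "U \<subseteq> reach B p"
      using unit_connected[OF U v] reach.step by blast
    then show ?thesis ..
  qed blast
qed

section \<open>Bridges and doubly entered triangles\<close>

definition doubly_entered_triangle :: bool where
  "doubly_entered_triangle \<longleftrightarrow>
     (\<exists>x y z x' y' z'. triangle_unit x y z x' y' z' \<and> y' \<in> reach {x, y, z} x')"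

text \<open>Induction on the size of a union \<open>X\<close> of units whose only leaving edge is
  \<open>p q\<close>. If the unit of \<open>p\<close> is a triangle, either its other two outer
  neighbors lie in one component after its removal, or the component of one of them is a smaller
  such set. If it is a diamond, deleting it from \<open>X\<close> leaves a smaller such set.\<close>

lemma bridge_imp_doubly_entered:
  assumes "X \<subseteq> verts G" "saturated X" "p \<in> X" "q \<notin> X" "q \<in> nbs p"
    and "\<And>u v. u \<in> X \<Longrightarrow> v \<in> nbs u \<Longrightarrow> v \<notin> X \<Longrightarrow> u = p \<and> v = q"
  shows doubly_entered_triangle
  using assms
proof (induction "card X" arbitrary: X p q rule: less_induct)
  case (less X p q)
  note prems = less.prems
  have fin: "finite X"
    using prems(1) finite_verts finite_subset by blast
  obtain U where U: "U \<in> units" "p \<in> U"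
    using unit_exists prems(1,3) by blast
  then have UX: "U \<subseteq> X"
    using prems(2,3) unfolding saturated_def by blast
  have satU: "saturated U"
    using U(1) by (rule saturated_unit)
  have "q \<notin> U"
    using UX prems(4) by blast
  then consider y z y' z' where "U = {p, y, z}" "triangle_unit p y z q y' z'"
    | b c e e' where "U = {p, b, c, e}" "diamond_unit p b c e q e'"
    using unit_entry[OF U prems(5)] by blast
  then show ?case
  proof cases
    case 1
    note d = triangle_unitD[OF 1(2)]
    have in_X: "y \<in> X" "z \<in> X" "p \<noteq> y" "p \<noteq> z" "y \<noteq> z"
      using UX 1(1) d(4) by auto
    have "y' \<in> nbs y" "z' \<in> nbs z"
      by (simp_all add: d(2,3))
    \<comment> \<open>The only edge leaving \<open>X\<close> starts at \<open>p\<close>, so the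
      outer edges at \<open>y\<close> and \<open>z\<close> stay inside \<open>X\<close>.\<close>
    then have y'X: "y' \<in> X" "z' \<in> X"
      using prems(6)[of y y'] prems(6)[of z z'] in_X by blast+
    have out: "y' \<notin> U" "z' \<notin> U"
      unfolding 1(1) using d(4) by auto
    show ?thesis
    proof (cases "z' \<in> reach U y'")
      case True
      moreover have "U = {y, z, p}"
        using 1(1) by auto
      ultimately show ?thesis
        unfolding doubly_entered_triangle_def using triangle_unit_perm(2)[OF 1(2)] by blast
    next
      case False
      let ?C = "reach U y'"
      have sub: "?C \<subseteq> X"
        using y'X(1)
      proof (rule reach_subset)
        fix u v assume "u \<in> X" "u \<notin> U" "v \<in> nbs u"
        then show "v \<in> X \<or> v \<in> U"
          using prems(6) U(2) by blast
      qed
      have "?C \<subset> X"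
        using sub reach_avoids U(2) prems(3) by blast
      then have "card ?C < card X"
        using fin psubset_card_mono by blast
      moreover have "?C \<subseteq> verts G"
        using sub prems(1) by blast
      moreover have "saturated ?C"
        using satU by (rule saturated_reach)
      moreover have "y' \<in> ?C"
        using out(1) by (rule reach.base)
      moreover have "y \<notin> ?C"
        using reach_avoids 1(1) by blast
      moreover have "y \<in> nbs y'"
        using d(2) nbs_sym by blast
      moreover have "u = y' \<and> v = y" if "u \<in> ?C" "v \<in> nbs u" "v \<notin> ?C" for u v
      proof -
        \<comment> \<open>An edge leaving the component ends in \<open>U\<close>. Its inner end is
          neither \<open>q\<close>, which is outside \<open>X\<close>, nor \<open>z'\<close>, so it
          is \<open>y'\<close>.\<close>
        have "v \<in> U"
          using that reach.step by blast
        moreover have "u \<notin> U" "u \<in> X" "u \<in> nbs v" "u \<noteq> q" "u \<noteq> z'"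
          using that reach_avoids sub prems(4) False nbs_sym by blast+
        ultimately show ?thesis
          unfolding 1(1) by (elim insertE emptyE) (auto simp: d(1-3))
      qed
      ultimately show ?thesis
        by (rule less.hyps)
    qed
  next
    case 2
    note d = diamond_unitD[OF 2(2)]
    have e: "e \<in> X" "p \<noteq> e"
      using UX 2(1) d(5) by auto
    have e': "e' \<in> X" "e' \<notin> U"
    proof -
      have "e' \<in> nbs e"
        by (simp add: d(4))
      then show "e' \<in> X"
        using prems(6)[of e e'] e by blast
      show "e' \<notin> U"
        unfolding 2(1) by (rule d(7))
    qed
    let ?C = "X - U"
    have "?C \<subset> X"
      using U(2) prems(3) by blast
    then have "card ?C < card X"
      using fin psubset_card_mono by blast
    moreover have "?C \<subseteq> verts G"
      using prems(1) by blast
    moreover have "saturated ?C"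
      using prems(2) satU by (rule saturated_Diff)
    moreover have "e' \<in> ?C"
      using e' by blast
    moreover have "e \<notin> ?C"
      using 2(1) by blast
    moreover have "e \<in> nbs e'"
      using d(4) nbs_sym by blast
    moreover have "u = e' \<and> v = e" if "u \<in> ?C" "v \<in> nbs u" "v \<notin> ?C" for u v
    proof -
      \<comment> \<open>If \<open>v\<close> were outside \<open>X\<close>, the edge would start at
        \<open>p\<close>, which has been deleted with \<open>U\<close>. The ends \<open>p\<close>,
        \<open>b\<close>, \<open>c\<close> of the diamond have no neighbor in \<open>X - U\<close>,
        so only \<open>e\<close> remains.\<close>
      have "v \<in> U"
        using that prems(6)[of u v] U(2) by blast
      moreover have "u \<notin> {p, b, c, e}" "u \<in> nbs v" "u \<noteq> q"
        using that 2(1) prems(4) nbs_sym by blast+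
      ultimately show ?thesis
        unfolding 2(1) by (elim insertE emptyE) (auto simp: d(1-4))
    qed
    ultimately show ?thesis
      by (rule less.hyps)
  qed
qed

text \<open>Otherwise the component of \<open>x'\<close> after deleting the triangle misses
  \<open>y'\<close> and \<open>z'\<close>. Its only leaving edge is then \<open>x' x\<close>, and
  \<open>bridge_imp_doubly_entered\<close> applies to it.\<close>

lemma triangle_imp_doubly_entered:
  assumes "triangle_unit x y z x' y' z'"
  shows doubly_entered_triangle
proof (rule ccontr)
  assume no: "\<not> doubly_entered_triangle"
  note d = triangle_unitD[OF assms]
  let ?T = "{x, y, z}" and ?C = "reach {x, y, z} x'"
  have "y' \<notin> ?C"
    using no assms unfolding doubly_entered_triangle_def by blast
  moreover have "z' \<notin> ?C"
  proof -
    have "?T = {x, z, y}" by auto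
    then show ?thesis
      using no triangle_unit_perm(4)[OF assms] unfolding doubly_entered_triangle_def by metis
  qed
  ultimately have no': "y' \<notin> ?C" "z' \<notin> ?C" .
  have x': "x' \<in> ?C"
    using d(4) by (auto intro: reach.base)
  moreover have "?C \<subseteq> verts G"
  proof (rule reach_subset)
    show "x' \<in> verts G"
      using nbs_verts d(1) by blast
  qed (use nbs_verts in blast)
  moreover have "saturated ?C"
    using assms by (intro saturated_reach saturated_unit triangle_in_units)
  moreover have "x \<notin> ?C"
    using reach_avoids by blast
  moreover have "x \<in> nbs x'"
    using d(1) nbs_sym by blast
  moreover have "u = x' \<and> v = x" if "u \<in> ?C" "v \<in> nbs u" "v \<notin> ?C" for u v
  proof -
    have "v \<in> ?T"
      using that reach.step by blast
    moreover have "u \<notin> ?T" "u \<in> nbs v" "u \<noteq> y'" "u \<noteq> z'"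
      using that reach_avoids no' nbs_sym by blast+
    ultimately show ?thesis
      by (elim insertE emptyE) (auto simp: d(1-3))
  qed
  ultimately have doubly_entered_triangle
    using bridge_imp_doubly_entered[of ?C x' x] by blast
  then show False
    using no by blast
qed

section \<open>Exploring the graph unit by unit\<close>

lemma independent_set_insert:
  assumes "independent_set G I" "w \<in> verts G" "nbs w \<inter> I = {}"
  shows "independent_set G (insert w I)"
  using assms nbs_sym unfolding independent_set_def nbs_def by blast

lemma card_le_independence_number: "independent_set G I \<Longrightarrow> card I \<le> independence_number G"
  unfolding independence_number_def using finite_independent_sets by (intro Max_ge) auto

lemma card_le_matching_number: "matching G M \<Longrightarrow> card M \<le> matching_number G"
  unfolding matching_number_def using finite_matchings by (intro Max_ge) auto

lemma zero_forcing_number_le_card: "zero_forcing_set G S \<Longrightarrow> zero_forcing_number G \<le> card S"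
  unfolding zero_forcing_number_def using finite_zero_forcing_sets by (intro Min_le) auto

lemma matching_insert:
  assumes "matching G M" "v \<in> nbs u" "u \<notin> \<Union>M" "v \<notin> \<Union>M"
  shows "matching G (insert {u, v} M)" "card (insert {u, v} M) = card M + 1"
proof -
  have "M \<subseteq> Pow (verts G)"
    using assms(1) nbs_verts unfolding matching_def edges_def nbs_def by blast
  then have "finite M"
    by (rule finite_subset) simp
  moreover have "{u, v} \<notin> M"
    using assms(3) by blast
  ultimately show "card (insert {u, v} M) = card M + 1"
    by simp
  have "{u, v} \<in> edges G"
    using assms(2) unfolding edges_def nbs_def by blast
  then show "matching G (insert {u, v} M)"
    using assms(1,3,4) unfolding matching_def pairwise_def disjnt_def by blast
qed

section \<open>The exploration invariant and its extension by one unit\<close>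

abbreviation no_triangle_unit :: bool where
  "no_triangle_unit \<equiv> \<forall>x y z x' y' z'. \<not> triangle_unit x y z x' y' z'"

text \<open>
  \<open>X\<close> is the explored set, forced by \<open>S\<close>. Neighbors of \<open>I\<close> outside \<open>X\<close> lie in \<open>W\<close>, so that a triangle
  entered at a vertex outside \<open>W\<close> can add its entry vertex to \<open>I\<close>; diamonds do not need this.
  The vertices in \<open>E\<close> are kept free for matching edges that are added later.
\<close>

definition config :: "'a set \<Rightarrow> 'a set \<Rightarrow> 'a set \<Rightarrow> 'a set \<Rightarrow> 'a set \<Rightarrow> 'a set set \<Rightarrow> bool" where
  "config W E X S I M \<longleftrightarrow> X \<subseteq> verts G \<and> saturated X \<and> E \<subseteq> X \<and> S \<subseteq> X \<and> X \<subseteq> forced S \<and>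
     I \<subseteq> X \<and> independent_set G I \<and> (no_triangle_unit \<or> (\<forall>i\<in>I. nbs i \<subseteq> X \<union> W)) \<and>
     matching G M \<and> \<Union>M \<subseteq> X - E"

text \<open>Every vertex has at least two of its three neighbors in its own unit.\<close>

lemma outer_neighbor_unique:
  assumes "saturated X" "v \<in> X" "w \<in> nbs v" "w \<notin> X"
  shows "nbs v - {w} \<subseteq> X"
proof -
  obtain U where U: "U \<in> units" "v \<in> U"
    using unit_exists nbs_verts assms(3) by blast
  then have UX: "U \<subseteq> X"
    using assms(1,2) unfolding saturated_def by blast
  then have "w \<notin> U"
    using assms(4) by blast
  then obtain p q where "p \<in> U" "q \<in> U" "nbs v = {p, q, w}"
    using unit_entry[OF U assms(3)] by (metis triangle_unitD(1) diamond_unitD(1) insertCI)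
  then show ?thesis
    using UX by auto
qed

lemma forced_entry:
  assumes "saturated X" "v \<in> X" "w \<in> nbs v" "w \<notin> X" "X \<subseteq> forced S"
  shows "w \<in> forced S"
proof (rule forced.step)
  show "v \<in> forced S" "w \<in> nbs v"
    using assms by blast+
  show "t \<in> forced S" if "t \<in> nbs v" "t \<noteq> w" for t
    using outer_neighbor_unique[OF assms(1-4)] assms(5) that by blast
qed

lemma triangle_forced:
  assumes "triangle_unit x y z x' y' z'" "x \<in> forced S" "y \<in> forced S" "x' \<in> forced S"
  shows "{x, y, z} \<subseteq> forced S"
proof -
  note d = triangle_unitD[OF assms(1)]
  have "z \<in> forced S"
    by (rule forced.step[OF assms(2)]) (use assms in \<open>auto simp: d(1)\<close>)
  then show ?thesis
    using assms by blast
qed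

text \<open>First \<open>a\<close> forces \<open>c\<close> if necessary, then \<open>b\<close>
  forces \<open>e\<close>. The alternative \<open>c\<close> serves the first unit of an exploration,
  where \<open>a'\<close> need not be colored; the alternative \<open>a'\<close> serves a unit
  entered through \<open>a\<close>.\<close>

lemma diamond_forced:
  assumes "diamond_unit a b c e a' e'" "a \<in> forced S" "b \<in> forced S" "c \<in> forced S \<or> a' \<in> forced S"
  shows "{a, b, c, e} \<subseteq> forced S"
proof -
  note d = diamond_unitD[OF assms(1)]
  have c: "c \<in> forced S"
    using assms(4)
  proof
    assume "a' \<in> forced S"
    with assms(3) show ?thesis
      by - (rule forced.step[OF assms(2)], auto simp: d(1))
  qed
  have "e \<in> forced S"
    by (rule forced.step[OF assms(3)]) (use assms c in \<open>auto simp: d(2)\<close>)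
  then show ?thesis
    using assms c by blast
qed

lemma unit_verts: "U \<in> units \<Longrightarrow> U \<subseteq> verts G"
proof (erule units_cases)
  fix x y z x' y' z' assume *: "U = {x, y, z}" "triangle_unit x y z x' y' z'"
  note d = triangle_unitD[OF *(2)]
  have "y \<in> nbs x" "z \<in> nbs x"
    by (simp_all add: d)
  then show "U \<subseteq> verts G"
    unfolding *(1) using nbs_verts by blast
next
  fix a b c e a' e' assume *: "U = {a, b, c, e}" "diamond_unit a b c e a' e'"
  note d = diamond_unitD[OF *(2)]
  have "a \<in> nbs b" "c \<in> nbs b" "e \<in> nbs b"
    by (simp_all add: d)
  then show "U \<subseteq> verts G"
    unfolding *(1) using nbs_verts by blast
qed

text \<open>The entry vertex \<open>w\<close> is forced by \<open>v\<close>. In a triangle,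
  \<open>y\<close> is colored in addition, \<open>w\<close> joins the independent set and
  \<open>w y\<close> the matching. In a diamond, the center \<open>b\<close> is colored and joins
  the independent set, and \<open>w b\<close>, \<open>c e\<close> join the matching. The set
  \<open>B\<close> is the forbidden region.\<close>

lemma config_step:
  assumes cfg: "config W E X S I M"
    and "saturated B" "W \<subseteq> B" "v \<in> X" "w \<in> nbs v" "w \<notin> X" "w \<notin> B"
  obtains U S' I' M' where "w \<in> U" "U \<inter> B = {}" "config W E (X \<union> U) S' I' M'"
    "card S' = card S + 1" "card I' = card I + 1" "card M' \<ge> card M + 1"
    "no_triangle_unit \<Longrightarrow> card M' \<ge> card M + 2"
proof -
  note conclude = that
  have X: "X \<subseteq> verts G" "saturated X" "E \<subseteq> X" "S \<subseteq> X" "X \<subseteq> forced S" "I \<subseteq> X"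
    "independent_set G I" "no_triangle_unit \<or> (\<forall>i\<in>I. nbs i \<subseteq> X \<union> W)" "matching G M" "\<Union>M \<subseteq> X - E"
    using cfg unfolding config_def by simp_all
  have fin: "finite S" "finite I"
    by (rule finite_subset[OF _ finite_verts], use X(1,4,6) in blast)+
  have v: "v \<in> nbs w"
    using assms(5) nbs_sym by blast
  obtain U where U: "U \<in> units" "w \<in> U"
    using unit_exists nbs_verts assms(5) by blast
  have disj: "U \<inter> X = {}" "U \<inter> B = {}"
    using X(2) U assms(2,6,7) unfolding saturated_def by blast+
  have satXU: "saturated (X \<union> U)" and vertsXU: "X \<union> U \<subseteq> verts G"
    using X(1,2) U(1) saturated_Un saturated_unit unit_verts by blast+
  have forced: "w \<in> forced S" "X \<subseteq> forced S"
    using forced_entry[OF X(2) assms(4-6) X(5)] X(5) by blast+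
  \<comment> \<open>Bookkeeping common to both kinds of units: \<open>s\<close> is the new colored
    vertex, \<open>i\<close> the new independent one.\<close>
  have grow: thesis
    if s: "s \<in> U" and i: "i \<in> U" "nbs i \<inter> I = {}" "no_triangle_unit \<or> nbs i \<subseteq> X \<union> U"
      and F: "U \<subseteq> forced (insert s S)"
      and N: "matching G M'" "card M' \<ge> card M + 1" "\<Union>M' \<subseteq> \<Union>M \<union> U" "no_triangle_unit \<Longrightarrow> card M' \<ge> card M + 2"
    for s i M'
  proof (rule conclude[of U "insert s S" "insert i I" M'])
    have "X \<subseteq> forced (insert s S)"
      using X(5) forced_mono[of S "insert s S"] by blast
    moreover have "independent_set G (insert i I)"
      using X(7) i(1,2) vertsXU by (intro independent_set_insert) auto
    moreover have "\<Union>M' \<subseteq> X \<union> U - E"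
      using N(3) X(3,10) disj(1) by blast
    moreover have "no_triangle_unit \<or> (\<forall>j\<in>insert i I. nbs j \<subseteq> X \<union> U \<union> W)"
      using X(8) i(3) by blast
    ultimately show "config W E (X \<union> U) (insert s S) (insert i I) M'"
      unfolding config_def using satXU vertsXU X(3,4,6) F N(1) s i(1) by blast
    have "s \<notin> S" "i \<notin> I"
      using disj X(4,6) s i(1) by blast+
    then show "card (insert s S) = card S + 1" "card (insert i I) = card I + 1"
      using fin by simp_all
  qed (use U disj N in auto)
  have "v \<notin> U"
    using assms(4) disj(1) by blast
  then consider y z y' z' where "U = {w, y, z}" "triangle_unit w y z v y' z'"
    | b c e e' where "U = {w, b, c, e}" "diamond_unit w b c e v e'"
    using unit_entry[OF U v] by blast
  then show ?thesis
  proof cases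
    case 1
    note d = triangle_unitD[OF 1(2)]
    have tri: "\<not> no_triangle_unit"
      using 1(2) by blast
    have "nbs w \<inter> I = {}"
    proof -
      \<comment> \<open>A neighbor of \<open>I\<close> outside \<open>X\<close> lies in
        \<open>W\<close> and hence in \<open>B\<close>, but \<open>w\<close> does not.\<close>
      have "v \<notin> I"
        using X(8) tri assms(3,5-7) by blast
      moreover have "y \<notin> I" "z \<notin> I"
        using 1(1) disj(1) X(6) by blast+
      ultimately show ?thesis
        by (simp add: d(1))
    qed
    moreover have "nbs w \<subseteq> X \<union> U"
      using assms(4) by (simp add: d(1) 1(1))
    moreover have "y \<in> U" "y \<notin> \<Union>M" "w \<notin> \<Union>M" "y \<in> nbs w"
      using 1(1) disj(1) X(10) d(1) by blast+
    moreover have "U \<subseteq> forced (insert y S)"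
      unfolding 1(1)
    proof (rule triangle_forced[OF 1(2)])
      show "w \<in> forced (insert y S)" "v \<in> forced (insert y S)"
        using forced assms(4) forced_mono[of S "insert y S"] by blast+
      show "y \<in> forced (insert y S)"
        by (rule forced.base) simp
    qed
    moreover have "\<Union>(insert {w, y} M) \<subseteq> \<Union>M \<union> U"
      using 1(1) by blast
    ultimately show ?thesis
      using grow[of y w "insert {w, y} M"] U(2) matching_insert[OF X(9), of y w] tri by simp
  next
    case 2
    note d = diamond_unitD[OF 2(2)]
    \<comment> \<open>All neighbors of a center lie in the diamond, so no condition on the earlier
      members of \<open>I\<close> is involved.\<close>
    have "nbs b \<subseteq> U" "nbs b \<inter> I = {}"
      using disj(1) X(6) unfolding 2(1) d(2) by auto
    moreover have "U \<subseteq> forced (insert b S)"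
      unfolding 2(1)
    proof (rule diamond_forced[OF 2(2)])
      show "w \<in> forced (insert b S)" "c \<in> forced (insert b S) \<or> v \<in> forced (insert b S)"
        using forced assms(4) forced_mono[of S "insert b S"] by blast+
      show "b \<in> forced (insert b S)"
        by (rule forced.base) simp
    qed
    moreover have M1: "matching G (insert {w, b} M)" "card (insert {w, b} M) = card M + 1"
      using matching_insert[OF X(9), of b w] 2(1) disj(1) X(10) d(1) by blast+
    moreover have "c \<notin> \<Union>(insert {w, b} M)" "e \<notin> \<Union>(insert {w, b} M)"
      using 2(1) disj(1) X(10) d(5) by auto
    then have "matching G (insert {c, e} (insert {w, b} M))"
      "card (insert {c, e} (insert {w, b} M)) = card M + 2"
      using matching_insert[OF M1(1), of e c] M1(2) d(3) by simp_all
    moreover have "\<Union>(insert {c, e} (insert {w, b} M)) \<subseteq> \<Union>M \<union> U" "b \<in> U"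
      unfolding 2(1) by blast+
    ultimately show ?thesis
      using grow[of b b "insert {c, e} (insert {w, b} M)"] by auto
  qed
qed

text \<open>Iterate \<open>config_step\<close> until every edge leaving the explored set ends in
  \<open>B\<close>; \<open>k\<close> counts the added units. The number of unexplored vertices
  decreases.\<close>

lemma config_close:
  assumes "config W E X S I M" "saturated B" "W \<subseteq> B" "X \<inter> B = {}"
  obtains X' S' I' M' k where "config W E X' S' I' M'" "X \<subseteq> X'" "X' \<inter> B = {}"
    "card S' = card S + k" "card I' = card I + k" "card M' \<ge> card M + k"
    "\<And>u v. u \<in> X' \<Longrightarrow> v \<in> nbs u \<Longrightarrow> v \<in> X' \<or> v \<in> B"
proof -
  have "\<exists>X' S' I' M' k. config W E X' S' I' M' \<and> X \<subseteq> X' \<and> X' \<inter> B = {} \<and>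
    card S' = card S + k \<and> card I' = card I + k \<and> card M' \<ge> card M + k \<and>
    (\<forall>u v. u \<in> X' \<longrightarrow> v \<in> nbs u \<longrightarrow> v \<in> X' \<or> v \<in> B)"
    using assms(1,4)
  proof (induction "card (verts G - X)" arbitrary: X S I M rule: less_induct)
    case (less X S I M)
    show ?case
    proof (cases "\<forall>u v. u \<in> X \<longrightarrow> v \<in> nbs u \<longrightarrow> v \<in> X \<or> v \<in> B")
      case True
      then show ?thesis
        using less.prems by (intro exI[of _ X] exI[of _ S] exI[of _ I] exI[of _ M] exI[of _ 0]) simp
    next
      case False
      then obtain v w where vw: "v \<in> X" "w \<in> nbs v" "w \<notin> X" "w \<notin> B"
        by blast
      obtain U S1 I1 M1 where step: "w \<in> U" "U \<inter> B = {}" "config W E (X \<union> U) S1 I1 M1"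
        "card S1 = card S + 1" "card I1 = card I + 1" "card M1 \<ge> card M + 1"
        using config_step[OF less.prems(1) assms(2,3) vw] .
      have "w \<in> verts G"
        using vw(2) nbs_verts by blast
      then have "verts G - (X \<union> U) \<subset> verts G - X"
        using step(1) vw(3) by blast
      then have "card (verts G - (X \<union> U)) < card (verts G - X)"
        by (intro psubset_card_mono) simp_all
      moreover have "(X \<union> U) \<inter> B = {}"
        using less.prems(2) step(2) by blast
      ultimately obtain X' S' I' M' k where IH: "config W E X' S' I' M'" "X \<union> U \<subseteq> X'" "X' \<inter> B = {}"
        "card S' = card S1 + k" "card I' = card I1 + k" "card M' \<ge> card M1 + k"
        "\<forall>u v. u \<in> X' \<longrightarrow> v \<in> nbs u \<longrightarrow> v \<in> X' \<or> v \<in> B"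
        using less.hyps[OF _ step(3)] by metis
      show ?thesis
        by (rule exI[of _ X'], rule exI[of _ S'], rule exI[of _ I'], rule exI[of _ M'], rule exI[of _ "k + 1"])
          (use IH step in auto)
    qed
  qed
  then show ?thesis
    using that by metis
qed

section \<open>Starting configurations and the final count\<close>

lemma config_bounds:
  assumes "config {} {} X S I M" "X \<noteq> {}" "card S \<le> card I + 1" "card S \<le> card M"
  shows "zero_forcing_number G \<le> independence_number G + 1 \<and> zero_forcing_number G \<le> matching_number G"
proof -
  obtain X' S' I' M' k where c: "config {} {} X' S' I' M'" "X \<subseteq> X'"
    "card S' = card S + k" "card I' = card I + k" "card M' \<ge> card M + k"
    "\<And>u v. u \<in> X' \<Longrightarrow> v \<in> nbs u \<Longrightarrow> v \<in> X' \<or> v \<in> {}"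
    using config_close[OF assms(1) saturated_empty] by (metis empty_subsetI inf_bot_right)
  have d: "X' \<subseteq> verts G" "S' \<subseteq> X'" "X' \<subseteq> forced S'" "independent_set G I'" "matching G M'"
    using c(1) unfolding config_def by simp_all
  have "X' = verts G"
  proof (rule ccontr)
    assume "X' \<noteq> verts G"
    then show False
      using leaving_edge[OF d(1)] c(2,6) assms(2) by blast
  qed
  then have "zero_forcing_set G S'"
    using d by (intro zero_forcing_setI) simp_all
  \<comment> \<open>\<open>S\<close> and \<open>I\<close> have grown by the same \<open>k\<close>
    and \<open>M\<close> by at least \<open>k\<close>, so both inequalities between the initial
    cardinalities persist.\<close>
  then show ?thesis
    using zero_forcing_number_le_card[of S'] card_le_independence_number[OF d(4)]
      card_le_matching_number[OF d(5)] c(3-5) assms(3,4) by linarith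
qed

text \<open>The first diamond gives 3 colored vertices, 2 independent ones (its tips) and 2 matching
  edges, one edge too few. The next diamond adds 1, 1 and at least 2, which gives 4, 3 and at least
  4, as \<open>config_bounds\<close> requires.\<close>

lemma bounds_no_triangle:
  assumes no_triangle_unit
  shows "zero_forcing_number G \<le> independence_number G + 1 \<and> zero_forcing_number G \<le> matching_number G"
proof -
  have "verts G \<noteq> {}"
    using symmetric_connected_imp_strongly_connected[OF sym_arcs conn]
    unfolding strongly_connected_def by blast
  then obtain U where U: "U \<in> units"
    using unit_exists by blast
  then obtain a b c e a' e' where D: "U = {a, b, c, e}" "diamond_unit a b c e a' e'"
    using assms by (metis units_cases)
  note d = diamond_unitD[OF D(2)]
  have nb: "a \<in> nbs b" "e \<in> nbs c" "a' \<in> nbs a"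
    by (simp_all add: d)
  have V: "U \<subseteq> verts G"
    using U by (rule unit_verts)
  have F: "U \<subseteq> forced {a, b, c}"
    unfolding D(1) by (rule diamond_forced[OF D(2)]) (simp_all add: forced.base)
  have I: "independent_set G {a, e}"
  proof (intro independent_set_insert independent_set_empty)
    show "a \<in> verts G" "e \<in> verts G"
      using V D(1) by blast+
    show "nbs a \<inter> {e} = {}"
      using d(5,7) d(6) by (auto simp: d(1))
  qed simp
  have M1: "matching G {{c, e}}" "card {{c, e}} = 1"
    using matching_insert[OF matching_empty nb(2)] by simp_all
  have M: "matching G {{b, a}, {c, e}}" "card {{b, a}, {c, e}} = 2"
    using matching_insert[OF M1(1) nb(1)] M1(2) d(5) by auto
  have cfg: "config {} {} U {a, b, c} {a, e} {{b, a}, {c, e}}"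
    unfolding config_def using assms V F I M(1) saturated_unit[OF U] D(1) by blast
  \<comment> \<open>The outer neighbor \<open>a'\<close> of the tip \<open>a\<close> provides the
    entry to a second diamond.\<close>
  have a: "a \<in> U" "a' \<notin> U" "a' \<notin> {}"
    using D(1) d(6) by blast+
  obtain U2 S2 I2 M2 where step: "config {} {} (U \<union> U2) S2 I2 M2" "card S2 = card {a, b, c} + 1"
    "card I2 = card {a, e} + 1" "card M2 \<ge> card {{b, a}, {c, e}} + 2"
    by (rule config_step[OF cfg saturated_empty empty_subsetI a(1) nb(3) a(2,3)]) (use assms in blast)
  have "card {a, b, c} = 3" "card {a, e} = 2"
    using d(5) by simp_all
  then show ?thesis
    using step(2-4) M(2) a(1) by (intro config_bounds[OF step(1)]) auto
qed

text \<open>Starting in the unit \<open>U\<close> of \<open>x'\<close> and adding \<open>k\<close>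
  units outside \<open>T\<close> gives \<open>3 + k\<close> colored vertices, \<open>1 + k\<close>
  independent ones and at least \<open>k\<close> matching edges that avoid \<open>U\<close>. Then
  \<open>T\<close> costs nothing and yields one more independent vertex, and \<open>U\<close> and
  \<open>T\<close> together carry three more edges.\<close>

lemma bounds_triangle:
  assumes doubly_entered_triangle
  shows "zero_forcing_number G \<le> independence_number G + 1 \<and> zero_forcing_number G \<le> matching_number G"
proof -
  obtain x y z x' y' z' where T: "triangle_unit x y z x' y' z'" and conn': "y' \<in> reach {x, y, z} x'"
    using assms unfolding doubly_entered_triangle_def by blast
  define T where "T = {x, y, z}"
  note d = triangle_unitD[OF T]
  have Tu: "T \<in> units" and tri: "\<not> no_triangle_unit"
    unfolding T_def using T triangle_in_units by blast+
  have nb: "x' \<in> nbs x" "y' \<in> nbs y" "y \<in> nbs z" "z \<in> nbs y"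
    by (simp_all add: d)
  then have nb': "x \<in> nbs x'" "y \<in> nbs y'"
    using nbs_sym by blast+
  have x'T: "x' \<notin> T"
    unfolding T_def using d(4) by auto
  obtain U where U: "U \<in> units" "x' \<in> U"
    using unit_exists nbs_verts nb(1) by blast
  have UT: "U \<inter> T = {}"
    using unit_unique[OF U(1) Tu] x'T U(2) by blast
  have UV: "U \<subseteq> verts G" and TV: "T \<subseteq> verts G"
    using U(1) Tu by (simp_all add: unit_verts)
  have xU: "x \<notin> U"
    using UT T_def by blast
  \<comment> \<open>In a triangle take \<open>S = U\<close> and \<open>i = x'\<close>; in a diamond
    take the tip \<open>x'\<close> and both centers for \<open>S\<close>, and a center for
    \<open>i\<close>. The edge \<open>p q\<close> avoids \<open>x'\<close>, which is reserved for
    the edge to \<open>x\<close>.\<close>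
  have "\<exists>S i. S \<subseteq> U \<and> card S = 3 \<and> U \<subseteq> forced S \<and> i \<in> U \<and> nbs i \<subseteq> U \<union> {x}"
    and M0: "\<exists>p q. p \<in> U \<and> q \<in> U \<and> q \<in> nbs p \<and> x' \<noteq> p \<and> x' \<noteq> q"
  proof -
    consider p q p' q' where "U = {x', p, q}" "triangle_unit x' p q x p' q'"
      | b c e e' where "U = {x', b, c, e}" "diamond_unit x' b c e x e'"
      using unit_entry[OF U nb'(1) xU] by blast
    then have "(\<exists>S i. S \<subseteq> U \<and> card S = 3 \<and> U \<subseteq> forced S \<and> i \<in> U \<and> nbs i \<subseteq> U \<union> {x}) \<and>
      (\<exists>p q. p \<in> U \<and> q \<in> U \<and> q \<in> nbs p \<and> x' \<noteq> p \<and> x' \<noteq> q)"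
    proof cases
      case 1
      note t = triangle_unitD[OF 1(2)]
      have "card U = 3" "x' \<noteq> p" "x' \<noteq> q"
        unfolding 1(1) using t(4) by auto
      moreover have "nbs x' \<subseteq> U \<union> {x}" "q \<in> nbs p" "p \<in> U" "q \<in> U"
        unfolding t 1(1) by auto
      moreover have "U \<subseteq> forced U"
        using forced.base by blast
      ultimately show ?thesis
        using U(2) by blast
    next
      case 2
      note t = diamond_unitD[OF 2(2)]
      have "card {x', b, c} = 3" "x' \<noteq> e" "x' \<noteq> c"
        using t(5) by auto
      moreover have "{x', b, c} \<subseteq> U" "nbs b \<subseteq> U \<union> {x}" "e \<in> nbs c" "b \<in> U" "c \<in> U" "e \<in> U"
        unfolding t(2,3) 2(1) by auto
      moreover have "U \<subseteq> forced {x', b, c}"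
        unfolding 2(1) by (rule diamond_forced[OF 2(2)]) (simp_all add: forced.base)
      ultimately show ?thesis
        by blast
    qed
    then show "\<exists>S i. S \<subseteq> U \<and> card S = 3 \<and> U \<subseteq> forced S \<and> i \<in> U \<and> nbs i \<subseteq> U \<union> {x}"
      and "\<exists>p q. p \<in> U \<and> q \<in> U \<and> q \<in> nbs p \<and> x' \<noteq> p \<and> x' \<noteq> q"
      by blast+
  qed
  then obtain S0 i0 where S0: "S0 \<subseteq> U" "card S0 = 3" "U \<subseteq> forced S0" "i0 \<in> U" "nbs i0 \<subseteq> U \<union> {x}"
    by blast
  obtain p q where pq: "p \<in> U" "q \<in> U" "q \<in> nbs p" "x' \<noteq> p" "x' \<noteq> q"
    using M0 by blast
  have "independent_set G {i0}"
    by (rule independent_set_insert[OF independent_set_empty]) (use S0(4) UV in auto)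
  \<comment> \<open>With \<open>W = {x}\<close>, the only neighbor of the independent set that may
    remain outside is \<open>x\<close>; \<open>E = U\<close> keeps \<open>U\<close> free for the
    matching.\<close>
  then have cfg: "config {x} U U S0 {i0} {}"
    unfolding config_def using UV saturated_unit[OF U(1)] S0 matching_empty by blast
  have xT: "{x} \<subseteq> T"
    unfolding T_def by blast
  obtain X S I M k where X: "config {x} U X S I M" "U \<subseteq> X" "X \<inter> T = {}" "card S = card S0 + k"
    "card I = card {i0} + k" "card M \<ge> k"
    "\<And>u v. u \<in> X \<Longrightarrow> v \<in> nbs u \<Longrightarrow> v \<in> X \<or> v \<in> T"
    by (rule config_close[OF cfg saturated_unit[OF Tu] xT UT]) simp
  have c: "X \<subseteq> verts G" "saturated X" "S \<subseteq> X" "X \<subseteq> forced S" "I \<subseteq> X" "independent_set G I"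
    "\<forall>i\<in>I. nbs i \<subseteq> X \<union> {x}" "matching G M" "\<Union>M \<subseteq> X - U"
    using X(1) tri unfolding config_def by simp_all
  have x'X: "x' \<in> X"
    using X(2) U(2) by blast
  then have "reach T x' \<subseteq> X"
    by (rule reach_subset) (use X(7) in blast)
  then have y'X: "y' \<in> X"
    using conn' unfolding T_def by blast
  have TX: "x \<notin> X" "y \<notin> X" "z \<notin> X"
    using X(3) unfolding T_def by blast+
  \<comment> \<open>Both \<open>x'\<close> and \<open>y'\<close> are explored, so they force
    \<open>x\<close> and \<open>y\<close>; then \<open>x\<close> forces \<open>z\<close>.\<close>
  have forced: "x \<in> forced S" "y \<in> forced S" "x' \<in> forced S"
    using forced_entry[OF c(2) x'X nb'(1) TX(1) c(4)] forced_entry[OF c(2) y'X nb'(2) TX(2) c(4)]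
      x'X c(4) by blast+
  have F: "T \<subseteq> forced S"
    unfolding T_def by (rule triangle_forced[OF T forced])
  have ne: "x \<noteq> y" "x \<noteq> z" "y \<noteq> z"
    using d(4) by auto
  \<comment> \<open>A member of \<open>I\<close> has no neighbor outside \<open>X\<close> except
    possibly \<open>x\<close>, while \<open>y'\<close> is adjacent to \<open>y\<close>. This is why
    \<open>y\<close>, and not \<open>x\<close>, is added to \<open>I\<close>.\<close>
  have "y' \<notin> I"
    using c(7) nb'(2) TX(2) ne(1) by blast
  then have "nbs y \<inter> I = {}"
    using TX c(5) by (auto simp: d(2))
  moreover have "y \<in> verts G"
    using TV T_def by blast
  ultimately have I: "independent_set G (insert y I)"
    using c(6) by (intro independent_set_insert)
  have "finite I"
    by (rule finite_subset[OF _ finite_verts]) (use c(1,5) in blast)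
  then have card_I: "card (insert y I) = card I + 1"
    using TX(2) c(5) by (subst card_insert_disjoint) auto
  have off: "x' \<notin> \<Union>M" "p \<notin> \<Union>M" "q \<notin> \<Union>M" "x \<notin> \<Union>M" "y \<notin> \<Union>M" "z \<notin> \<Union>M"
    using c(9) U(2) pq(1,2) TX by blast+
  have neU: "x' \<noteq> x" "x' \<noteq> y" "x' \<noteq> z" "p \<noteq> x" "p \<noteq> y" "p \<noteq> z" "q \<noteq> x" "q \<noteq> y" "q \<noteq> z"
    using x'X pq(1,2) X(2) TX by blast+
  \<comment> \<open>The three extra edges: \<open>p q\<close> inside \<open>U\<close>,
    \<open>x x'\<close> between \<open>T\<close> and \<open>U\<close>, and \<open>y z\<close> inside
    \<open>T\<close>.\<close>
  let ?M1 = "insert {p, q} M"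
  let ?M2 = "insert {x, x'} ?M1"
  let ?M3 = "insert {y, z} ?M2"
  have M1: "matching G ?M1" "card ?M1 = card M + 1"
    using matching_insert[OF c(8) pq(3)] off by blast+
  have "x \<notin> \<Union>?M1" "x' \<notin> \<Union>?M1"
    using off neU pq by auto
  then have M2: "matching G ?M2" "card ?M2 = card M + 2"
    using matching_insert[OF M1(1) nb(1)] M1(2) by simp_all
  have "y \<notin> \<Union>?M2" "z \<notin> \<Union>?M2"
    using off neU ne by auto
  then have M3: "matching G ?M3" "card ?M3 = card M + 3"
    using matching_insert[OF M2(1) nb(4)] M2(2) by simp_all
  have cover: "\<Union>?M3 \<subseteq> X \<union> T - {}"
    using c(9) pq(1,2) x'X X(2) unfolding T_def by blast
  have closed: "\<forall>i\<in>insert y I. nbs i \<subseteq> X \<union> T \<union> {}"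
    using c(7) y'X unfolding T_def by (auto simp: d(2))
  have "insert y I \<subseteq> X \<union> T" "X \<union> T \<subseteq> verts G" "S \<subseteq> X \<union> T" "X \<union> T \<subseteq> forced S"
    using c(1,3-5) TV F unfolding T_def by blast+
  then have "config {} {} (X \<union> T) S (insert y I) ?M3"
    unfolding config_def
    by (intro conjI disjI2 empty_subsetI I M3(1) cover closed saturated_Un c(2) saturated_unit Tu)
  then show ?thesis
    by (rule config_bounds) (use x'X X(4-6) S0(2) card_I M3(2) in auto)
qed

end

theorem theorem3p1:
  fixes G :: "('a, 'b) pre_digraph"
  assumes "graph G"
    and "Digraph_Component.connected G"
    and "claw_free G"
    and "cubic G"
    and "\<not> K\<^bsub>4\<^esub> G"
  shows "zero_forcing_number G \<le> independence_number G + 1 \<and>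
         zero_forcing_number G \<le> matching_number G"
proof -
  interpret connected_claw_free_cubic G
    using assms by (intro connected_claw_free_cubic.intro connected_claw_free_cubic_axioms.intro)
  show ?thesis
    \<comment> \<open>Either all units are diamonds, or some triangle unit exists and then a doubly
      entered one does.\<close>
    using bounds_no_triangle bounds_triangle triangle_imp_doubly_entered by blast
qed

end
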